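(* Let $V$ be a vector space, $U\subseteq V$ a subspace, and $\mathcal C,\mathcal E:V\to V$ linear operators. Assume that integers $m\ge 1$ and $k\ge 2$ are such that: 1. if $(I-\mathcal C^m)v\in U$ for $v\in V$, then $v\in U$; 2. $\mathcal Cu\in U$ and $\mathcal Eu\in U$ for all $u\in U$; 3. $\operatorname{sgn}(m-1)\,\mathcal C\mathcal Eu$, $\mathcal E\mathcal Cu$ and $\mathcal E^ku$ belong to $U$ for all $u\in V$. Then for any $u\in V$ satisfying $u-\mathcal Cu-\mathcal Eu\in U$, it follows that $u\in U$.
   Context: $I$ denotes the identity operator on $V$; $\operatorname{sgn}(0)=0$ and $\operatorname{sgn}(s)=1$ for $s>0$, so the condition on $\mathcal C\mathcal E u$ is void when $m=1$. *)

theory Defs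
  imports Complex_Main
begin

end

(* Modulo U, applying E to u = C u + E u and using E C = 0 gives E u = E (E u), hence
   E u = E^k u = 0.  So u = C u modulo U, hence u = C^m u modulo U, and the first
   hypothesis applies. *)

theory Submission
  imports Defs
begin

text \<open>Since \<open>C\<close> and \<open>E\<close> preserve \<open>U\<close>, both act on the
  quotient by \<open>U\<close>. There an operator that fixes a class has powers that fix it too:
  this is \<open>diff_funpow_mem_subspace\<close>, used once for \<open>E\<close> at the vector
  \<open>E u\<close> and once for \<open>C\<close> at \<open>u\<close>.\<close>

text \<open>Induction on \<open>n\<close>, by telescoping: x - f^(n+1) x = (x - f x) + f (x - f^n
  x), where invariance of \<open>U\<close> under \<open>f\<close> handles the last term.\<close>

lemma (in module) diff_funpow_mem_subspace:
  assumes "subspace U" and "module_hom scale scale f"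
    and "\<And>v. v \<in> U \<Longrightarrow> f v \<in> U" and "x - f x \<in> U"
  shows "x - (f ^^ n) x \<in> U"
proof (induction n)
  case 0
  show ?case using subspace_0[OF assms(1)] by simp
next
  case (Suc n)
  have "f (x - (f ^^ n) x) \<in> U" using Suc assms(3) by blast
  then have "f x - (f ^^ Suc n) x \<in> U" by (simp add: module_hom.diff[OF assms(2)])
  from subspace_add[OF assms(1,4) this] show ?case by simp
qed

theorem lemma2p1:
  fixes scale :: "'a::field \<Rightarrow> 'b::ab_group_add \<Rightarrow> 'b"
    and U :: "'b set"
    and C E :: "'b \<Rightarrow> 'b"
    and m k :: nat
    and u :: 'b
  assumes "vector_space scale"
    and "module.subspace scale U"
    and "Vector_Spaces.linear scale scale C"
    and "Vector_Spaces.linear scale scale E"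
    and "m \<ge> 1"
    and "k \<ge> 2"
    and "\<And>v. v - (C ^^ m) v \<in> U \<Longrightarrow> v \<in> U"
    and "\<And>v. v \<in> U \<Longrightarrow> C v \<in> U"
    and "\<And>v. v \<in> U \<Longrightarrow> E v \<in> U"
    and "\<And>v. scale (of_int (sgn (int m - 1))) (C (E v)) \<in> U"
    and "\<And>v. E (C v) \<in> U"
    and "\<And>v. (E ^^ k) v \<in> U"
    and "u - C u - E u \<in> U"
  shows "u \<in> U"
proof -
  interpret vector_space scale by fact
  note sub = \<open>module.subspace scale U\<close>
  \<comment> \<open>By linearity the added \<open>E (C u)\<close> cancels the mixed term, leaving
    \<open>E u - E (E u)\<close>.\<close>
  have "E (u - C u - E u) + E (C u) \<in> U"
    using assms(9)[OF assms(13)] assms(11)[of u] by (rule subspace_add[OF sub])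
  then have "E u - E (E u) \<in> U"
    using assms(4) by (simp add: linear_iff_module_hom module_hom.diff)
  \<comment> \<open>The exponent is \<open>k - 1\<close> because the vector \<open>E u\<close>
    already carries one factor \<open>E\<close>; as \<open>k\<close> is positive, the total is
    exactly \<open>k\<close>.\<close>
  then have "E u - (E ^^ (k - 1)) (E u) \<in> U"
    using assms(9) by (intro diff_funpow_mem_subspace[OF sub assms(4)])
  moreover have "(E ^^ (k - 1)) (E u) = (E ^^ k) u"
    using \<open>k \<ge> 2\<close> by (cases k) (simp_all add: funpow_swap1)
  ultimately have "E u - (E ^^ k) u \<in> U" by simp
  from subspace_add[OF sub this assms(12)[of u]] have "E u \<in> U" by simp
  from subspace_add[OF sub assms(13) this] have "u - C u \<in> U" by simp
  then have "u - (C ^^ m) u \<in> U"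
    using assms(8) by (intro diff_funpow_mem_subspace[OF sub assms(3)])
  then show ?thesis by (rule assms(7))
qed

end
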